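(* For $r,q\ge1$, let $\mathbb{X}\subset\mathcal{G}_{qr}$ denote any system of representatives of $\mathcal{G}_{qr}/\mathcal{G}_r$, where $\mathcal{G}_m$ is the group of complex $m$-th roots of unity, i.e. $\mathcal{G}_{qr}=\biguplus_{\tau\in\mathbb{X}}\tau\mathcal{G}_r$. With $\ell_r$ and $\Gamma_{y_r}$ as defined in the context: (1) For every $r\ge1$ and every odd $q\ge1$, one has, for $|z|<1$, $$e^{\ell_{qr}(z)}=\prod_{\chi\in\mathbb{X}}e^{\ell_r(\chi z)},\quad\text{or equivalently}\quad \Gamma^{-1}_{y_{qr}}(1+z)=\prod_{\chi\in\mathbb{X}}\Gamma^{-1}_{y_r}(1+\chi z).$$ (2) For $r,q\ge1$, $e^{\ell_r}$ divides $e^{\ell_{qr}}$ (as entire functions) if and only if $q$ is odd. (3) For every $r\ge1$, the full symmetry group of $e^{\ell_r}$ for the representation $s*f[z]=f(sz)$, i.e. the group of $s\in\mathbb{C}^\times$ such that $e^{\ell_r}(sz)=e^{\ell_r}(z)$ for all $z$, is $\mathcal{G}_r$.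
   Context: $\zeta$ is the Riemann zeta function, $\gamma$ Euler's constant. For $|z|<1$ put $$\ell_1(z):=\gamma z-\sum_{k\ge2}\zeta(k)\frac{(-z)^k}{k},\qquad \ell_r(z):=-\sum_{k\ge1}\zeta(kr)\frac{(-z^r)^k}{k}\ \text{ for } r\ge2,$$ and $\Gamma_{y_r}(1+z):=e^{-\ell_r(z)}$, so that the reciprocal $\Gamma_{y_r}^{-1}(1+z)$ equals $e^{\ell_r(z)}$. The function $e^{\ell_r}$ extends to an entire function on $\mathbb{C}$, still denoted $e^{\ell_r}$. *)

theory Defs
  imports "HOL-Complex_Analysis.Complex_Analysis"
begin

(* The Dirichlet series, which is the Riemann zeta function on Re s > 1.
   Below it is only evaluated at integers s \<ge> 2, so no continuation is needed. *)
definition zeta :: "complex \<Rightarrow> complex" where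
  "zeta s = (\<Sum>n. 1 / of_nat (Suc n) powr s)"

(* Meaningful for r \<ge> 1 and norm z < 1, where both series converge absolutely.
   The summation index is shifted: k stands for k + 2 in the case r = 1 and for k + 1 otherwise. *)
definition ell :: "nat \<Rightarrow> complex \<Rightarrow> complex" where
  "ell r z =
     (if r = 1
      then euler_mascheroni * z
             - (\<Sum>k. zeta (of_nat (k + 2)) * (- z) ^ (k + 2) / of_nat (k + 2))
      else - (\<Sum>k. zeta (of_nat ((k + 1) * r)) * (- (z ^ r)) ^ (k + 1) / of_nat (k + 1)))"

(* Gamma_y r (1 + z) = exp (- ell r z), for z in the open unit disc. *)
definition Gamma_y :: "nat \<Rightarrow> complex \<Rightarrow> complex" where
  "Gamma_y r w = exp (- ell r (w - 1))"

(* The entire function extending exp (ell r z) from the open unit disc;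
   it is unique by the identity theorem. *)
definition exp_ell :: "nat \<Rightarrow> complex \<Rightarrow> complex" where
  "exp_ell r =
     (THE f. f holomorphic_on UNIV \<and> (\<forall>z. norm z < 1 \<longrightarrow> f z = exp (ell r z)))"

definition entire_dvd :: "(complex \<Rightarrow> complex) \<Rightarrow> (complex \<Rightarrow> complex) \<Rightarrow> bool" where
  "entire_dvd f g \<longleftrightarrow> (\<exists>h. h holomorphic_on UNIV \<and> (\<forall>z. g z = f z * h z))"

definition roots_of_1 :: "nat \<Rightarrow> complex set" where
  "roots_of_1 m = {z. z ^ m = 1}"

definition is_rep_system :: "complex set \<Rightarrow> nat \<Rightarrow> nat \<Rightarrow> bool" where
  "is_rep_system X q r \<longleftrightarrow>
     X \<subseteq> roots_of_1 (q * r) \<and>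
     roots_of_1 (q * r) = (\<Union>\<tau>\<in>X. (*) \<tau> ` roots_of_1 r) \<and>
     disjoint_family_on (\<lambda>\<tau>. (*) \<tau> ` roots_of_1 r) X"

definition symmetry_group :: "(complex \<Rightarrow> complex) \<Rightarrow> complex set" where
  "symmetry_group f = {s. s \<noteq> 0 \<and> (\<forall>z. f (s * z) = f z)}"

end

theory Submission
  imports Defs
begin

text \<open>
  Comparing Taylor coefficients of the log-Gamma function at 1 gives
  \<open>ell 1 z = - ln_Gamma (1 + z)\<close>. Since the power sums of the solutions of
  \<open>\<omega> ^ r = (-1) ^ (r + 1)\<close> vanish in all exponents not divisible by \<open>r\<close>, the sum of
  \<open>ell 1 (\<omega> * z)\<close> over these \<open>\<omega>\<close> is \<open>ell r z\<close>. Hence the entire extension of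
  \<open>exp \<circ> ell r\<close> is the finite product of the functions \<open>1 / \<Gamma> (1 + \<omega> z)\<close>, with zeros exactly
  at the solutions of \<open>z ^ r = - (n ^ r)\<close> for positive integers \<open>n\<close>. All claims are read off
  this product and its zero set.
\<close>

section \<open>Twisted roots of unity and their power sums\<close>

text \<open>The sign is the one for which the values \<open>ell 1 (w * z)\<close> sum to
  \<open>ell r z\<close>. For odd \<open>r\<close> these are the r-th roots of 1, for even
  \<open>r\<close> those of -1.\<close>

definition twisted_roots :: "nat \<Rightarrow> complex set" where
  "twisted_roots r = {w. w ^ r = (-1) ^ (r + 1)}"

definition rGamma_prod :: "nat \<Rightarrow> complex \<Rightarrow> complex" where
  "rGamma_prod r z = (\<Prod>w\<in>twisted_roots r. rGamma (1 + w * z))"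

lemma finite_twisted_roots: "r > 0 \<Longrightarrow> finite (twisted_roots r)"
  by (auto simp: twisted_roots_def)

lemma card_twisted_roots: "r > 0 \<Longrightarrow> card (twisted_roots r) = r"
  unfolding twisted_roots_def by (rule card_nth_roots) auto

lemma twisted_roots_1: "twisted_roots 1 = {1}"
  by (auto simp: twisted_roots_def)

lemma norm_twisted_root:
  assumes "w \<in> twisted_roots r" "r > 0"
  shows "norm w = 1"
proof -
  have "(w ^ r) ^ 2 = 1"
    using assms by (simp add: twisted_roots_def flip: power_mult)
  then have "w ^ (r * 2) = 1"
    by (simp only: power_mult)
  with assms show ?thesis
    by (auto dest: power_eq_1_iff)
qed

text \<open>The quotient of two solutions is an r-th root of unity. This carries coset
  decompositions of \<open>roots_of_1\<close> over to products over twisted roots.\<close>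

lemma twisted_roots_eq_coset:
  assumes "s \<in> twisted_roots r" "r > 0"
  shows "twisted_roots r = (*) s ` roots_of_1 r"
proof -
  have s: "s \<noteq> 0"
    using norm_twisted_root[OF assms] by auto
  have "w \<in> (*) s ` roots_of_1 r" if "w \<in> twisted_roots r" for w
    using that assms s
    by (intro image_eqI[of _ _ "w / s"])
       (auto simp: twisted_roots_def roots_of_1_def power_divide)
  moreover have "s * g \<in> twisted_roots r" if "g \<in> roots_of_1 r" for g
    using that assms by (auto simp: twisted_roots_def roots_of_1_def power_mult_distrib)
  ultimately show ?thesis
    by blast
qed

lemma twisted_roots_mult_invariant:
  assumes "s \<in> roots_of_1 r" "r > 0"
  shows "bij_betw ((*) s) (twisted_roots r) (twisted_roots r)"
proof -
  have "s \<noteq> 0"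
    using assms by (auto simp: roots_of_1_def zero_power)
  then show ?thesis
    using assms
    by (intro bij_betwI[where g = "\<lambda>w. w / s"])
       (auto simp: twisted_roots_def roots_of_1_def power_mult_distrib power_divide)
qed

text \<open>For odd \<open>q\<close> the numbers \<open>q * r + 1\<close> and \<open>r + 1\<close>
  have the same parity. Both the factorization and the divisibility rest on this inclusion.\<close>

lemma twisted_roots_subset:
  assumes "odd q"
  shows "twisted_roots r \<subseteq> twisted_roots (q * r)"
proof
  fix w assume "w \<in> twisted_roots r"
  then have "w ^ (q * r) = ((-1) ^ (r + 1)) ^ q"
    by (simp add: twisted_roots_def power_mult mult.commute[of q])
  also have "\<dots> = (-1) ^ (q * r + 1)"
    using assms by (cases "even r") (auto simp: uminus_power_if)
  finally show "w \<in> twisted_roots (q * r)"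
    by (simp add: twisted_roots_def)
qed

text \<open>Multiplication by the primitive root of unity \<open>u\<close> permutes the twisted
  roots, so the sum equals \<open>u ^ k\<close> times itself, and \<open>u ^ k\<close> is not
  1.\<close>

lemma sum_power_twisted_roots:
  assumes "r > 0" "\<not> r dvd k"
  shows "(\<Sum>w\<in>twisted_roots r. w ^ k) = 0"
proof -
  define u where "u = exp (2 * of_real pi * \<i> / of_nat r)"
  have u_pow: "u ^ j = exp (2 * of_real pi * \<i> * of_nat j / of_nat r)" for j
    unfolding u_def by (simp flip: exp_of_nat_mult add: field_simps)
  have u: "u \<in> roots_of_1 r" "u ^ k \<noteq> 1"
    using complex_root_unity_eq_1[of r r] complex_root_unity_eq_1[of r k] assms
    by (auto simp: roots_of_1_def u_pow)
  have "(\<Sum>w\<in>twisted_roots r. w ^ k) = (\<Sum>w\<in>twisted_roots r. (u * w) ^ k)"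
    by (rule sum.reindex_bij_betw[symmetric]) (rule twisted_roots_mult_invariant[OF u(1) assms(1)])
  also have "\<dots> = u ^ k * (\<Sum>w\<in>twisted_roots r. w ^ k)"
    by (simp add: power_mult_distrib sum_distrib_left)
  finally show ?thesis
    using u(2) by simp
qed

lemma sum_power_twisted_roots_multiple:
  assumes "r > 0"
  shows "(\<Sum>w\<in>twisted_roots r. w ^ (m * r)) = of_nat r * (-1) ^ ((r + 1) * m)"
proof -
  have "w ^ (m * r) = (-1) ^ ((r + 1) * m)" if "w \<in> twisted_roots r" for w
    using that by (simp add: twisted_roots_def mult.commute[of m] power_mult del: mult_Suc)
  then show ?thesis
    by (simp add: card_twisted_roots assms)
qed

section \<open>Taylor expansion of the log-Gamma function at 1\<close>

text \<open>Taylor coefficients of \<open>- ln_Gamma (1 + z)\<close> at 0. The constant term is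
  \<open>- ln_Gamma 1 = 0\<close>; at exponent 1, where the zeta series diverges, Euler's constant
  takes its place.\<close>

definition ell_coeff :: "nat \<Rightarrow> complex" where
  "ell_coeff k = (if k = 0 then 0 else if k = 1 then euler_mascheroni
                  else - zeta (of_nat k) * (-1) ^ k / of_nat k)"

lemma Polygamma_at_1:
  assumes "n > 0"
  shows "Polygamma n (1 :: complex) = (-1) ^ Suc n * fact n * zeta (of_nat (Suc n))"
proof -
  have "inverse ((1 + of_nat k :: complex) ^ Suc n) = 1 / of_nat (Suc k) powr of_nat (Suc n)" for k
    by (subst powr_nat') (auto simp: divide_inverse simp del: of_nat_Suc power_Suc simp flip: of_nat_Suc)
  then show ?thesis
    using assms by (simp add: Polygamma_def zeta_def)
qed

text \<open>The disc of radius 1 about 1 avoids the branch cut of \<open>ln_Gamma\<close>, so the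
  Taylor series converges there; the derivatives at 1 of positive order are polygamma
  values.\<close>

lemma sums_neg_ln_Gamma:
  fixes z :: complex
  assumes "norm z < 1"
  shows "(\<lambda>k. ell_coeff k * z ^ k) sums (- ln_Gamma (1 + z))"
proof -
  have "ball (1::complex) 1 \<inter> \<real>\<^sub>\<le>\<^sub>0 = {}"
  proof (safe; simp)
    fix x :: complex assume "dist 1 x < 1" "x \<in> \<real>\<^sub>\<le>\<^sub>0"
    then show False
      using abs_Re_le_cmod[of "1 - x"] by (auto simp: dist_norm complex_nonpos_Reals_iff)
  qed
  then have "ln_Gamma holomorphic_on ball (1::complex) 1"
    by (rule holomorphic_ln_Gamma)
  from holomorphic_power_series[OF this, of "1 + z"] assms
  have "(\<lambda>n. (deriv ^^ n) ln_Gamma 1 / fact n * z ^ n) sums ln_Gamma (1 + z)"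
    by (simp add: dist_norm)
  then have "(\<lambda>n. - ((deriv ^^ n) ln_Gamma 1 / fact n * z ^ n)) sums (- ln_Gamma (1 + z))"
    by (rule sums_minus)
  moreover have "- ((deriv ^^ n) ln_Gamma 1 / fact n * z ^ n) = ell_coeff n * z ^ n" for n
  proof -
    consider "n = 0" | "n = 1" | m where "n = Suc m" "m > 0"
      by (metis One_nat_def gr0I not0_implies_Suc)
    then show ?thesis
    proof cases
      case 3
      then show ?thesis
        by (subst higher_deriv_ln_Gamma_complex)
           (auto simp: Polygamma_at_1 ell_coeff_def complex_nonpos_Reals_iff divide_simps simp del: of_nat_Suc)
    qed (use ln_Gamma_complex_of_real[of 1] ln_Gamma_real_pos[of 1] in
           \<open>auto simp: higher_deriv_ln_Gamma_complex ell_coeff_def complex_nonpos_Reals_iff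
              simp del: funpow.simps\<close>)
  qed
  ultimately show ?thesis
    by simp
qed

lemma ell_1_eq:
  assumes "norm z < 1"
  shows "ell 1 z = - ln_Gamma (1 + z)"
proof -
  \<comment> \<open>The series in \<open>ell 1\<close> starts at exponent 2, so the first two terms
    are split off.\<close>
  have "(\<lambda>k. ell_coeff (k + 2) * z ^ (k + 2)) sums
          (- ln_Gamma (1 + z) - (\<Sum>k<2. ell_coeff k * z ^ k))"
    using sums_neg_ln_Gamma[OF assms]
    by (subst sums_iff_shift) simp
  then have "(\<lambda>k. - (ell_coeff (k + 2) * z ^ (k + 2))) sums
          - (- ln_Gamma (1 + z) - (\<Sum>k<2. ell_coeff k * z ^ k))"
    by (rule sums_minus)
  also have "- (- ln_Gamma (1 + z) - (\<Sum>k<2. ell_coeff k * z ^ k))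
      = ln_Gamma (1 + z) + euler_mascheroni * z"
    by (simp add: ell_coeff_def eval_nat_numeral)
  also have "(\<lambda>k. - (ell_coeff (k + 2) * z ^ (k + 2)))
      = (\<lambda>k. zeta (of_nat (k + 2)) * (- z) ^ (k + 2) / of_nat (k + 2))"
    by (simp add: fun_eq_iff ell_coeff_def power_minus[of z])
  finally show ?thesis
    unfolding ell_def by (simp add: sums_iff)
qed

text \<open>Summing the expansions of \<open>- ln_Gamma (1 + w * z)\<close> over \<open>w\<close>
  multiplies the k-th coefficient by a power sum, which leaves only the multiples of
  \<open>r\<close>.\<close>

lemma ell_eq_sum_ln_Gamma:
  assumes "r > 0" "norm z < 1"
  shows "ell r z = (\<Sum>w\<in>twisted_roots r. - ln_Gamma (1 + w * z))"
proof (cases "r = 1")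
  case True
  then show ?thesis
    using assms by (simp add: ell_1_eq[unfolded One_nat_def] twisted_roots_1[unfolded One_nat_def])
next
  case False
  define S where "S = (\<Sum>w\<in>twisted_roots r. - ln_Gamma (1 + w * z))"
  define f where "f k = (\<Sum>w\<in>twisted_roots r. w ^ k) * (ell_coeff k * z ^ k)" for k
  have "(\<lambda>k. \<Sum>w\<in>twisted_roots r. ell_coeff k * (w * z) ^ k) sums S"
    unfolding S_def using assms
    by (intro sums_sum sums_neg_ln_Gamma) (simp add: norm_mult norm_twisted_root)
  also have "(\<lambda>k. \<Sum>w\<in>twisted_roots r. ell_coeff k * (w * z) ^ k) = f"
    by (simp add: f_def fun_eq_iff power_mult_distrib sum_distrib_left sum_distrib_right mult_ac)
  finally have "f sums S" .
  moreover have "strict_mono (\<lambda>j. (j + 1) * r)"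
    using assms by (auto simp: strict_mono_def)
  moreover have "f k = 0" if "k \<notin> range (\<lambda>j. (j + 1) * r)" for k
  proof (cases "r dvd k")
    case True
    then obtain m where m: "k = m * r"
      using dvdE by (metis mult.commute)
    \<comment> \<open>The only multiple of \<open>r\<close> outside the range is 0, where
      \<open>ell_coeff\<close> vanishes.\<close>
    with that have "m = 0"
      by (cases m) auto
    then show ?thesis
      by (simp add: m f_def ell_coeff_def)
  qed (use assms in \<open>simp add: f_def sum_power_twisted_roots\<close>)
  ultimately have "(\<lambda>j. f ((j + 1) * r)) sums S"
    by (subst sums_mono_reindex)
  moreover have "f ((j + 1) * r)
      = - (zeta (of_nat ((j + 1) * r)) * (- (z ^ r)) ^ (j + 1) / of_nat (j + 1))" for j
  proof -
    define m where "m = j + 1"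
    \<comment> \<open>Here \<open>r\<close> is at least 2, so Euler's constant, the coefficient at
      exponent 1, never enters.\<close>
    have m: "m > 0" "m * r \<noteq> 1" "m * r \<noteq> 0"
      using False assms by (auto simp: m_def)
    have "ell_coeff (m * r) = - zeta (of_nat (m * r)) * (-1) ^ (m * r) / of_nat (m * r)"
      using m by (simp only: ell_coeff_def if_False)
    then have "f (m * r) = (of_nat r * (-1) ^ ((r + 1) * m)) *
            (- zeta (of_nat (m * r)) * (-1) ^ (m * r) / of_nat (m * r) * z ^ (m * r))"
      using assms by (simp only: f_def sum_power_twisted_roots_multiple)
    also have "\<dots> = - zeta (of_nat (m * r)) * ((-1) ^ ((r + 1) * m) * (-1) ^ (m * r)) *
                    z ^ (m * r) / of_nat m"
      using m by (simp add: field_simps)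
    \<comment> \<open>The exponents add up to \<open>2 * m * r + m\<close>, which has the parity of
      \<open>m\<close>.\<close>
    also have "(-1) ^ ((r + 1) * m) * (-1) ^ (m * r) = ((-1) ^ m :: complex)"
      by (cases "even m"; cases "even r") (auto simp: uminus_power_if)
    also have "z ^ (m * r) = (z ^ r) ^ m"
      by (simp add: mult.commute[of m] power_mult)
    finally show ?thesis
      by (simp add: m_def power_minus[of "z ^ r"])
  qed
  ultimately have "(\<lambda>j. - (zeta (of_nat ((j + 1) * r)) * (- (z ^ r)) ^ (j + 1) / of_nat (j + 1)))
      sums S"
    by simp
  from sums_minus[OF this]
  have "(\<lambda>j. zeta (of_nat ((j + 1) * r)) * (- (z ^ r)) ^ (j + 1) / of_nat (j + 1)) sums (- S)"
    by (simp only: minus_minus)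
  then have "ell r z = S"
    unfolding ell_def using False by (simp add: sums_iff)
  then show ?thesis
    by (simp only: S_def)
qed

section \<open>The entire extension as a product of reciprocal Gamma functions\<close>

lemma rGamma_eq_exp_ln_Gamma:
  fixes z :: complex
  assumes "norm z < 1"
  shows "rGamma (1 + z) = exp (- ln_Gamma (1 + z))"
proof -
  have "1 + z \<notin> \<int>\<^sub>\<le>\<^sub>0"
  proof
    assume "1 + z \<in> \<int>\<^sub>\<le>\<^sub>0"
    then obtain n where "1 + z = of_int n" "n \<le> 0"
      by (auto elim: nonpos_Ints_cases)
    then have "Re (1 + z) \<le> 0"
      by simp
    with abs_Re_le_cmod[of z] assms show False
      by simp
  qed
  then show ?thesis
    by (simp add: rGamma_complex_altdef)
qed

lemma exp_ell_eq_rGamma_prod_disc: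
  assumes "r > 0" "norm z < 1"
  shows "exp (ell r z) = rGamma_prod r z"
  using assms
  by (auto simp: ell_eq_sum_ln_Gamma rGamma_prod_def exp_sum finite_twisted_roots norm_mult
        norm_twisted_root rGamma_eq_exp_ln_Gamma intro!: prod.cong)

lemma holomorphic_rGamma_prod: "rGamma_prod r holomorphic_on A"
  unfolding rGamma_prod_def [abs_def] by (intro holomorphic_intros)

text \<open>The product is entire and agrees with \<open>exp (ell r z)\<close> on the unit disc. By
  the identity theorem it is the only such function, so the \<open>THE\<close> in
  \<open>exp_ell\<close> denotes it.\<close>

lemma exp_ell_eq_rGamma_prod:
  assumes "r > 0"
  shows "exp_ell r = rGamma_prod r"
  unfolding exp_ell_def
proof (rule the_equality)
  show "rGamma_prod r holomorphic_on UNIV \<and> (\<forall>z. norm z < 1 \<longrightarrow> rGamma_prod r z = exp (ell r z))"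
    using assms by (simp add: holomorphic_rGamma_prod exp_ell_eq_rGamma_prod_disc)
next
  fix f
  assume f: "f holomorphic_on UNIV \<and> (\<forall>z. norm z < 1 \<longrightarrow> f z = exp (ell r z))"
  show "f = rGamma_prod r"
  proof
    fix z
    show "f z = rGamma_prod r z"
      by (rule analytic_continuation_open[of "ball 0 1" UNIV])
         (use f assms in \<open>auto simp: holomorphic_rGamma_prod exp_ell_eq_rGamma_prod_disc\<close>)
  qed
qed

section \<open>Zeros of the product\<close>

lemma rGamma_1_plus_eq_0_iff: "rGamma (1 + z :: complex) = 0 \<longleftrightarrow> (\<exists>n::nat. n > 0 \<and> z = - of_nat n)"
proof
  assume "rGamma (1 + z) = 0"
  then obtain n :: nat where "1 + z = - of_nat n"
    by (auto simp: rGamma_eq_zero_iff elim: nonpos_Ints_cases')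
  then have "z = - of_nat (Suc n)"
    by (simp add: eq_neg_iff_add_eq_0 algebra_simps)
  then show "\<exists>n::nat. n > 0 \<and> z = - of_nat n"
    by blast
next
  assume "\<exists>n::nat. n > 0 \<and> z = - of_nat n"
  then obtain m where "z = - of_nat (Suc m)"
    by (metis gr0_implies_Suc)
  then have "1 + z = - of_nat m"
    by simp
  then show "rGamma (1 + z) = 0"
    by (simp add: rGamma_eq_zero_iff)
qed

text \<open>A factor vanishes when \<open>w * z = - n\<close> with \<open>n\<close> positive. Taking
  r-th powers eliminates \<open>w\<close>, whose r-th power is a known sign.\<close>

lemma rGamma_prod_eq_0_iff:
  assumes "r > 0"
  shows "rGamma_prod r z = 0 \<longleftrightarrow> (\<exists>n::nat. n > 0 \<and> z ^ r = - (of_nat n ^ r))"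
proof
  assume "rGamma_prod r z = 0"
  then obtain w n where w: "w ^ r = (-1) ^ (r + 1)" and n: "n > (0::nat)" "w * z = - of_nat n"
    using assms
    by (auto simp: rGamma_prod_def finite_twisted_roots rGamma_1_plus_eq_0_iff)
       (auto simp: twisted_roots_def)
  have "w ^ r * z ^ r = (-1) ^ r * of_nat n ^ r"
    using n by (metis power_mult_distrib power_minus)
  then have "z ^ r = - (of_nat n ^ r)"
    using w by (cases "even r") (auto simp: neg_equal_iff_equal minus_equation_iff[of "z ^ r"])
  with n show "\<exists>n::nat. n > 0 \<and> z ^ r = - (of_nat n ^ r)"
    by blast
next
  assume "\<exists>n::nat. n > 0 \<and> z ^ r = - (of_nat n ^ r)"
  then obtain n :: nat where n: "n > 0" "z ^ r = - (of_nat n ^ r)"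
    by blast
  then have z: "z \<noteq> 0"
    using assms by (auto simp: zero_power)
  \<comment> \<open>The equation \<open>w * z = - n\<close> forces this choice.\<close>
  define w where "w = - of_nat n / z"
  have "w ^ r = (-1) ^ (r + 1)"
    using n z by (simp add: w_def power_divide power_minus[of "of_nat n"] del: divide_minus_left)
  then have "w \<in> twisted_roots r"
    by (simp only: twisted_roots_def mem_Collect_eq)
  moreover have "w * z = - of_nat n"
    using z by (simp add: w_def)
  then have "rGamma (1 + w * z) = 0"
    using n rGamma_1_plus_eq_0_iff by blast
  ultimately show "rGamma_prod r z = 0"
    using assms by (auto simp: rGamma_prod_def finite_twisted_roots)
qed

text \<open>Supplies a zero of \<open>rGamma_prod r\<close>, the case \<open>n = 1\<close>, on which
  divisibility and symmetry are tested.\<close>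

lemma exists_nth_root_minus_1:
  assumes "r > 0"
  obtains z :: complex where "z ^ r = - 1"
proof -
  have "card {z::complex. z ^ r = - 1} = r"
    using assms by (intro card_nth_roots) auto
  with assms show ?thesis
    using that by (metis (mono_tags, lifting) card_gt_0_iff empty_Collect_eq)
qed

section \<open>Factorization over cosets, divisibility and symmetry\<close>

text \<open>As \<open>q\<close> is odd, a single \<open>s\<close> lies in both sets of twisted
  roots, so both are cosets of groups of roots of unity with the same representative
  \<open>s\<close>. The decomposition of \<open>roots_of_1 (q * r)\<close> then splits the
  product.\<close>

lemma rGamma_prod_rep_system:
  assumes "r > 0" "odd q" "is_rep_system X q r"
  shows "rGamma_prod (q * r) z = (\<Prod>\<tau>\<in>X. rGamma_prod r (\<tau> * z))"
proof -
  have qr: "q * r > 0"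
    using assms by (auto simp: odd_pos)
  have "card (twisted_roots r) > 0"
    using assms by (simp add: card_twisted_roots)
  then obtain s where s: "s \<in> twisted_roots r"
    by (metis card_gt_0_iff ex_in_conv)
  then have s': "s \<in> twisted_roots (q * r)"
    using twisted_roots_subset assms by blast
  have [simp]: "s \<noteq> 0"
    using norm_twisted_root[OF s] assms by auto
  have fin: "finite (roots_of_1 m)" if "m > 0" for m
    using that by (auto simp: roots_of_1_def)
  have X: "X \<subseteq> roots_of_1 (q * r)" "roots_of_1 (q * r) = (\<Union>\<tau>\<in>X. (*) \<tau> ` roots_of_1 r)"
    "disjoint_family_on (\<lambda>\<tau>. (*) \<tau> ` roots_of_1 r) X"
    using assms by (auto simp: is_rep_system_def)
  \<comment> \<open>Makes multiplication by \<open>\<tau>\<close> injective, as reindexing each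
    coset requires.\<close>
  have X0: "\<tau> \<noteq> 0" if "\<tau> \<in> X" for \<tau>
    using that X(1) qr by (auto simp: roots_of_1_def zero_power)
  have prod_eq: "rGamma_prod m y = (\<Prod>g\<in>roots_of_1 m. rGamma (1 + s * g * y))"
    if "s \<in> twisted_roots m" "m > 0" for m y
    unfolding rGamma_prod_def twisted_roots_eq_coset[OF that]
    by (subst prod.reindex) (auto simp: inj_on_def)
  have "rGamma_prod (q * r) z = (\<Prod>g\<in>(\<Union>\<tau>\<in>X. (*) \<tau> ` roots_of_1 r). rGamma (1 + s * g * z))"
    using prod_eq[OF s' qr] X(2) by simp
  also have "\<dots> = (\<Prod>\<tau>\<in>X. \<Prod>g\<in>(*) \<tau> ` roots_of_1 r. rGamma (1 + s * g * z))"
    using fin[OF assms(1)] finite_subset[OF X(1) fin[OF qr]] X(3)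
    by (intro prod.UNION_disjoint) (auto simp: disjoint_family_on_def)
  also have "\<dots> = (\<Prod>\<tau>\<in>X. \<Prod>g\<in>roots_of_1 r. rGamma (1 + s * g * (\<tau> * z)))"
    by (rule prod.cong[OF refl], subst prod.reindex) (use X0 in \<open>auto simp: inj_on_def mult_ac\<close>)
  also have "\<dots> = (\<Prod>\<tau>\<in>X. rGamma_prod r (\<tau> * z))"
    using prod_eq[OF s assms(1)] by simp
  finally show ?thesis .
qed

text \<open>For odd \<open>q\<close> the cofactor is the product over the remaining twisted roots.
  For even \<open>q\<close> a solution of \<open>z ^ r = - 1\<close> is a zero of the divisor, but
  \<open>z ^ (q * r) = 1\<close> is not of the form \<open>- (n ^ (q * r))\<close>.\<close>

lemma entire_dvd_rGamma_prod_iff: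
  assumes "r > 0" "q > 0"
  shows "entire_dvd (rGamma_prod r) (rGamma_prod (q * r)) \<longleftrightarrow> odd q"
proof
  assume "odd q"
  define h where "h z = (\<Prod>w\<in>twisted_roots (q * r) - twisted_roots r. rGamma (1 + w * z))" for z
  have "h holomorphic_on UNIV"
    unfolding h_def [abs_def] by (intro holomorphic_intros)
  moreover have "rGamma_prod (q * r) z = rGamma_prod r z * h z" for z
    unfolding rGamma_prod_def h_def using assms
    by (subst prod.subset_diff[OF twisted_roots_subset[OF \<open>odd q\<close>, of r] finite_twisted_roots])
       (simp_all add: mult.commute)
  ultimately show "entire_dvd (rGamma_prod r) (rGamma_prod (q * r))"
    unfolding entire_dvd_def by blast
next
  assume "entire_dvd (rGamma_prod r) (rGamma_prod (q * r))"
  then obtain h where h: "\<And>z. rGamma_prod (q * r) z = rGamma_prod r z * h z"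
    unfolding entire_dvd_def by blast
  obtain z :: complex where z: "z ^ r = - 1"
    using exists_nth_root_minus_1 assms by blast
  then have "rGamma_prod r z = 0"
    using assms by (auto simp: rGamma_prod_eq_0_iff intro!: exI[of _ 1])
  with h have "rGamma_prod (q * r) z = 0"
    by simp
  then obtain n :: nat where n: "z ^ (q * r) = - (of_nat n ^ (q * r))"
    using assms by (auto simp: rGamma_prod_eq_0_iff)
  show "odd q"
  proof
    assume "even q"
    then have "z ^ (q * r) = 1"
      using z by (simp add: mult.commute[of q] power_mult)
    with n have "of_nat (1 + n ^ (q * r)) = (0 :: complex)"
      by (metis eq_neg_iff_add_eq_0 of_nat_1 of_nat_add of_nat_power)
    then show False
      by (subst (asm) of_nat_eq_0_iff) simp
  qed
qed

text \<open>An r-th root of unity permutes the factors. Conversely, a symmetry \<open>s\<close> and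
  its inverse map zeros to zeros; applied to a zero with \<open>z ^ r = - 1\<close>, this makes
  \<open>s ^ r\<close> and its inverse natural numbers, hence both 1.\<close>

lemma symmetry_group_rGamma_prod:
  assumes "r > 0"
  shows "symmetry_group (rGamma_prod r) = roots_of_1 r"
proof (intro equalityI subsetI)
  fix s assume s: "s \<in> roots_of_1 r"
  have "rGamma_prod r (s * z) = rGamma_prod r z" for z
    unfolding rGamma_prod_def
    using prod.reindex_bij_betw[OF twisted_roots_mult_invariant[OF s assms],
        of "\<lambda>w. rGamma (1 + w * z)"]
    by (simp add: mult_ac)
  then show "s \<in> symmetry_group (rGamma_prod r)"
    using s assms by (auto simp: symmetry_group_def roots_of_1_def zero_power)
next
  fix s assume "s \<in> symmetry_group (rGamma_prod r)"
  then have s: "s \<noteq> 0" "\<And>z. rGamma_prod r (s * z) = rGamma_prod r z"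
    by (auto simp: symmetry_group_def)
  obtain z :: complex where z: "z ^ r = - 1"
    using exists_nth_root_minus_1 assms by blast
  then have 0: "rGamma_prod r z = 0"
    using assms by (auto simp: rGamma_prod_eq_0_iff intro!: exI[of _ 1])
  have "rGamma_prod r (s * z) = 0" "rGamma_prod r (z / s) = 0"
    using 0 s(2)[of z] s(2)[of "z / s"] s(1) by auto
  then obtain n m :: nat where nm: "(s * z) ^ r = - (of_nat n ^ r)" "(z / s) ^ r = - (of_nat m ^ r)"
    using assms by (auto simp: rGamma_prod_eq_0_iff)
  then have sn: "s ^ r = of_nat n ^ r" and sm: "1 / s ^ r = of_nat m ^ r"
    using z by (auto simp: power_mult_distrib power_divide)
  have "of_nat ((n * m) ^ r) = (of_nat n ^ r * of_nat m ^ r :: complex)"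
    by (simp add: power_mult_distrib)
  also have "\<dots> = s ^ r * (1 / s ^ r)"
    by (simp only: flip: sn sm)
  also have "\<dots> = of_nat 1"
    using s(1) by simp
  finally have "(n * m) ^ r = 1"
    by (simp only: of_nat_eq_iff)
  then have "n = 1"
    using assms by simp
  with sn show "s \<in> roots_of_1 r"
    by (simp add: roots_of_1_def)
qed

theorem proposition2p11:
  shows "(\<forall>(r::nat) (q::nat) (X::complex set). r \<ge> 1 \<longrightarrow> q \<ge> 1 \<longrightarrow> odd q \<longrightarrow> is_rep_system X q r \<longrightarrow>
            (\<forall>z::complex. norm z < 1 \<longrightarrow>
               exp (ell (q * r) z) = (\<Prod>\<tau>\<in>X. exp (ell r (\<tau> * z))) \<and>
               inverse (Gamma_y (q * r) (1 + z)) = (\<Prod>\<tau>\<in>X. inverse (Gamma_y r (1 + \<tau> * z)))))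
       \<and> (\<forall>(r::nat) (q::nat). r \<ge> 1 \<longrightarrow> q \<ge> 1 \<longrightarrow>
            (entire_dvd (exp_ell r) (exp_ell (q * r)) \<longleftrightarrow> odd q))
       \<and> (\<forall>r::nat. r \<ge> 1 \<longrightarrow> symmetry_group (exp_ell r) = roots_of_1 r)"
proof (intro conjI allI impI)
  fix r q :: nat and X :: "complex set" and z :: complex
  assume r: "r \<ge> 1" and q: "q \<ge> 1" "odd q" and X: "is_rep_system X q r" and z: "norm z < 1"
  \<comment> \<open>Elements of \<open>X\<close> have modulus 1, so every argument stays in the disc
    where \<open>exp (ell r z)\<close> equals the product.\<close>
  have "norm (\<tau> * z) < 1" if "\<tau> \<in> X" for \<tau>
  proof -
    have "\<tau> ^ (q * r) = 1"
      using that X by (auto simp: is_rep_system_def roots_of_1_def)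
    then have "norm \<tau> = 1"
      using q r by (auto dest: power_eq_1_iff)
    with z show ?thesis
      by (simp add: norm_mult)
  qed
  then show *: "exp (ell (q * r) z) = (\<Prod>\<tau>\<in>X. exp (ell r (\<tau> * z)))"
    using rGamma_prod_rep_system[OF _ q(2) X, of z] r q z
    by (simp add: exp_ell_eq_rGamma_prod_disc)
  have inverse_Gamma_y: "inverse (Gamma_y m (1 + y)) = exp (ell m y)" for m y
    by (simp add: Gamma_y_def exp_minus)
  show "inverse (Gamma_y (q * r) (1 + z)) = (\<Prod>\<tau>\<in>X. inverse (Gamma_y r (1 + \<tau> * z)))"
    unfolding inverse_Gamma_y by (rule *)
next
  fix r q :: nat
  assume "r \<ge> 1" "q \<ge> 1"
  then show "entire_dvd (exp_ell r) (exp_ell (q * r)) \<longleftrightarrow> odd q"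
    by (simp add: exp_ell_eq_rGamma_prod entire_dvd_rGamma_prod_iff)
next
  fix r :: nat
  assume "r \<ge> 1"
  then show "symmetry_group (exp_ell r) = roots_of_1 r"
    by (simp add: exp_ell_eq_rGamma_prod symmetry_group_rGamma_prod)
qed

end
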